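(* For all integers $m,k,n$ with $2\leq m<k\leq n$ and every $\tau\in T_k^m$, $$|S_n(T_k^m;\tau)|=(k-1)^{n-k}.$$
   Context: $S_n$ denotes the set of all permutations $\alpha=(\alpha_1,\dots,\alpha_n)$ of $\{1,\dots,n\}$, written in one-line notation. For $1\leq m\leq k$, $T_k^m=\{\sigma\in S_k\mid\sigma_1=m\}$ is the set of permutations of $\{1,\dots,k\}$ whose first entry is $m$. An occurrence of a pattern $\tau\in S_k$ in $\alpha\in S_n$ is a choice of indices $1\leq i_1<\dots<i_k\leq n$ such that $(\alpha_{i_1},\dots,\alpha_{i_k})$ is order-isomorphic to $(\tau_1,\dots,\tau_k)$ (i.e. $\alpha_{i_a}<\alpha_{i_b}$ if and only if $\tau_a<\tau_b$). The permutation $\alpha$ avoids $\tau$ if it has no occurrence of $\tau$, and contains $\tau$ exactly once if it has exactly one occurrence of $\tau$. For $\tau\in T_k^m$, $S_n(T_k^m;\tau)$ denotes the set of all permutations in $S_n$ that avoid every pattern in $T_k^m\setminus\{\tau\}$ and contain $\tau$ exactly once. *)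

theory Defs
  imports "HOL-Combinatorics.Multiset_Permutations"
begin

text \<open>
  A permutation in one-line notation is the list of its values \<open>1, \<dots>, n\<close>.
  List positions count from 0, so the entry \<open>\<alpha>\<^sub>i\<close> of the usual notation is \<open>\<alpha> ! (i - 1)\<close>.
\<close>

definition S :: "nat \<Rightarrow> nat list set" where
  "S n = permutations_of_set {1..n}"

definition T :: "nat \<Rightarrow> nat \<Rightarrow> nat list set" where
  "T k m = {\<sigma> \<in> S k. \<sigma> ! 0 = m}"

text \<open>
  An occurrence is the strictly increasing list of the chosen positions, so that
  distinct occurrences are distinct choices of positions.
\<close>

definition occurrences :: "nat list \<Rightarrow> nat list \<Rightarrow> nat list set" where
  "occurrences \<tau> \<alpha> =
     {ps. length ps = length \<tau> \<and> sorted_wrt (<) ps \<and> set ps \<subseteq> {..<length \<alpha>} \<and>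
          (\<forall>a<length \<tau>. \<forall>b<length \<tau>. \<alpha> ! (ps ! a) < \<alpha> ! (ps ! b) \<longleftrightarrow> \<tau> ! a < \<tau> ! b)}"

definition avoids :: "nat list \<Rightarrow> nat list \<Rightarrow> bool" where
  "avoids \<alpha> \<tau> \<longleftrightarrow> occurrences \<tau> \<alpha> = {}"

definition contains_once :: "nat list \<Rightarrow> nat list \<Rightarrow> bool" where
  "contains_once \<alpha> \<tau> \<longleftrightarrow> (\<exists>!ps. ps \<in> occurrences \<tau> \<alpha>)"

definition S_avoid_once :: "nat \<Rightarrow> nat list set \<Rightarrow> nat list \<Rightarrow> nat list set" where
  "S_avoid_once n P \<tau> =
     {\<alpha> \<in> S n. (\<forall>\<sigma> \<in> P - {\<tau>}. avoids \<alpha> \<sigma>) \<and> contains_once \<alpha> \<tau>}"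

end

theory Submission
  imports Defs
begin

text \<open>
  An occurrence of a pattern in \<open>T k m\<close> is nothing but a set of \<open>k\<close> entries whose leftmost one
  exceeds exactly \<open>m - 1\<close> of the others: every such set is order-isomorphic to one member of
  \<open>T k m\<close>. Hence a permutation avoids \<open>T k m - {\<tau>}\<close> and contains \<open>\<tau>\<close> once iff it has a
  single such set of entries and that set forms the pattern \<open>\<tau>\<close>
  (lemmas \<open>avoid_others_contains_once_iff\<close>, \<open>occurrence_values\<close> and \<open>occurrence_from_values\<close>).

  If the first entry \<open>a\<close> of a permutation has \<open>s\<close> smaller and \<open>g\<close> larger entries to its right,
  then \<open>(s choose (m - 1)) * (g choose (k - m))\<close> occurrences start at \<open>a\<close>. Since \<open>m - 1\<close> and
  \<open>k - m\<close> are both positive, this product equals 1 only for \<open>s = m - 1\<close> and \<open>g = k - m\<close>, that is,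
  only if the permutation has length \<open>k\<close>. In a longer permutation it therefore has to be 0
  (lemma \<open>two_T_occurrences\<close>), which means \<open>s < m - 1\<close> or \<open>g < k - m\<close>; the two conditions exclude
  each other and leave \<open>(m - 1) + (k - m) = k - 1\<close> values of \<open>a\<close> (lemma \<open>card_admissible\<close>).
  Once \<open>a\<close> is such a value, no occurrence uses it, and the rest of the permutation is an arbitrary
  sequence with the same property (lemma \<open>Cons_in_avoid_once_iff\<close>). So each of the first
  \<open>n - k\<close> entries can be chosen in \<open>k - 1\<close> ways, and the last \<open>k\<close> entries have to form the
  pattern \<open>\<tau>\<close> (lemma \<open>avoid_once_base\<close>).

  The remaining entries no longer form an initial segment \<open>{1..n}\<close>. The induction therefore runs
  over arrangements of an arbitrary finite set \<open>A\<close> of numbers, in which the rank of an element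
  replaces its value.
\<close>

section \<open>Ranks\<close>

text \<open>
  The element itself is counted, so that ranks start at 1 and each element of \<open>{1..k}\<close> is its own
  rank, as for the values of a permutation.
\<close>

definition rank :: "nat set \<Rightarrow> nat \<Rightarrow> nat" where
  "rank A x = card {y \<in> A. y \<le> x}"

lemma rank_less_iff:
  assumes "finite A" "x \<in> A" "y \<in> A"
  shows "rank A x < rank A y \<longleftrightarrow> x < y"
proof
  assume "x < y"
  then have "{z \<in> A. z \<le> x} \<subset> {z \<in> A. z \<le> y}"
    using assms by force
  then show "rank A x < rank A y"
    unfolding rank_def using assms(1) by (intro psubset_card_mono) auto
next
  assume less: "rank A x < rank A y"
  show "x < y"
  proof (rule ccontr)
    assume "\<not> x < y"
    then have "rank A y \<le> rank A x"
      unfolding rank_def using assms(1) by (intro card_mono) auto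
    with less show False by simp
  qed
qed

lemma inj_on_rank: "finite A \<Longrightarrow> inj_on (rank A) A"
  by (metis inj_onI linorder_neq_iff rank_less_iff)

lemma bij_betw_rank:
  assumes "finite A"
  shows "bij_betw (rank A) A {1..card A}"
proof -
  have "rank A ` A \<subseteq> {1..card A}"
  proof (rule image_subsetI)
    fix x assume "x \<in> A"
    then have "{y \<in> A. y \<le> x} \<noteq> {}" by auto
    then have "rank A x > 0" using assms by (auto simp: rank_def card_gt_0_iff)
    moreover have "rank A x \<le> card A"
      unfolding rank_def using assms by (intro card_mono) auto
    ultimately show "rank A x \<in> {1..card A}" by simp
  qed
  moreover have "card (rank A ` A) = card {1..card A}"
    using assms by (simp add: card_image inj_on_rank)
  ultimately have "rank A ` A = {1..card A}"
    by (intro card_subset_eq) auto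
  then show ?thesis using assms by (simp add: bij_betw_def inj_on_rank)
qed

lemma rank_atLeastAtMost: "x \<le> k \<Longrightarrow> rank {1..k} x = x"
proof -
  assume "x \<le> k"
  then have "{y \<in> {1..k}. y \<le> x} = {1..x}" by auto
  then show ?thesis by (simp add: rank_def)
qed

lemma card_greater_eq_diff_rank:
  assumes "finite A"
  shows "card {y \<in> A. x < y} = card A - rank A x"
proof -
  have "{y \<in> A. x < y} = A - {y \<in> A. y \<le> x}" by auto
  then show ?thesis unfolding rank_def using assms by (simp add: card_Diff_subset)
qed

lemma rank_eq_Suc_card_less:
  assumes "finite A" "x \<in> A"
  shows "rank A x = Suc (card {y \<in> A. y < x})"
proof -
  have "{y \<in> A. y \<le> x} = insert x {y \<in> A. y < x}" using assms by auto
  then show ?thesis unfolding rank_def using assms by simp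
qed

lemma rank_nth:
  assumes "distinct xs"
  shows "rank (set xs) (xs ! i) = card {j. j < length xs \<and> xs ! j \<le> xs ! i}"
proof -
  have "{y \<in> set xs. y \<le> xs ! i} = (!) xs ` {j. j < length xs \<and> xs ! j \<le> xs ! i}"
    by (auto simp: in_set_conv_nth)
  moreover have "inj_on ((!) xs) {j. j < length xs \<and> xs ! j \<le> xs ! i}"
    using assms by (auto intro!: inj_onI simp: nth_eq_iff_index_eq)
  ultimately show ?thesis by (simp add: rank_def card_image)
qed

text \<open>
  By the previous lemma the rank of an entry depends only on the relative order of the entries;
  this carries information from a pattern to its occurrences.
\<close>

lemma rank_nth_cong:
  fixes xs ys :: "nat list"
  assumes "distinct xs" "distinct ys" "length xs = length ys" "i < length xs"
    and "\<forall>a<length xs. \<forall>b<length xs. xs ! a < xs ! b \<longleftrightarrow> ys ! a < ys ! b"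
  shows "rank (set xs) (xs ! i) = rank (set ys) (ys ! i)"
proof -
  have "{j. j < length xs \<and> xs ! j \<le> xs ! i} = {j. j < length ys \<and> ys ! j \<le> ys ! i}"
    using assms(3-5) by (metis linorder_not_less)
  then show ?thesis using assms(1,2) by (simp add: rank_nth)
qed

text \<open>
  Corresponding entries have the same rank in a common set, and the rank determines the entry.
\<close>

lemma order_isomorphic_imp_eq:
  fixes xs ys :: "nat list"
  assumes "distinct xs" "distinct ys" "set xs = set ys"
    and "\<forall>a<length xs. \<forall>b<length xs. xs ! a < xs ! b \<longleftrightarrow> ys ! a < ys ! b"
  shows "xs = ys"
proof (rule nth_equalityI)
  show len: "length xs = length ys" using assms(1-3) by (metis distinct_card)
  fix i assume i: "i < length xs"
  have "rank (set xs) (xs ! i) = rank (set xs) (ys ! i)"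
    using rank_nth_cong[OF assms(1,2) len i assms(4)] assms(3) by simp
  then show "xs ! i = ys ! i"
    using inj_on_rank[of "set xs"] i len assms(3) by (metis List.finite_set inj_onD nth_mem)
qed

lemma in_TD:
  assumes "\<sigma> \<in> T k m"
  shows "distinct \<sigma>" "set \<sigma> = {1..k}" "length \<sigma> = k" "\<sigma> ! 0 = m"
  using assms by (auto simp: T_def S_def permutations_of_set_def distinct_card[symmetric])

section \<open>Occurrences\<close>

definition T_occurrences :: "nat \<Rightarrow> nat \<Rightarrow> nat list \<Rightarrow> nat list set" where
  "T_occurrences k m \<alpha> = (\<Union>\<sigma>\<in>T k m. occurrences \<sigma> \<alpha>)"

lemma occurrencesD:
  assumes "ps \<in> occurrences \<tau> \<alpha>"
  shows "length ps = length \<tau>" "sorted_wrt (<) ps" "distinct ps" "\<And>p. p \<in> set ps \<Longrightarrow> p < length \<alpha>"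
    "\<And>a b. a < length \<tau> \<Longrightarrow> b < length \<tau> \<Longrightarrow> \<alpha> ! (ps ! a) < \<alpha> ! (ps ! b) \<longleftrightarrow> \<tau> ! a < \<tau> ! b"
  using assms by (auto simp: occurrences_def strict_sorted_iff)

text \<open>
  Fixed positions display only one pattern, so an occurrence of \<open>\<tau>\<close> is never an occurrence of
  another member of \<open>T k m\<close>. This turns the two conditions on individual patterns into a
  condition on all occurrences together.
\<close>

lemma avoid_others_contains_once_iff:
  assumes "\<tau> \<in> T k m"
  shows "(\<forall>\<sigma>\<in>T k m - {\<tau>}. avoids \<alpha> \<sigma>) \<and> contains_once \<alpha> \<tau> \<longleftrightarrow>
         (\<exists>ps. T_occurrences k m \<alpha> = {ps} \<and> ps \<in> occurrences \<tau> \<alpha>)"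
proof
  assume *: "(\<forall>\<sigma>\<in>T k m - {\<tau>}. avoids \<alpha> \<sigma>) \<and> contains_once \<alpha> \<tau>"
  then obtain ps where "occurrences \<tau> \<alpha> = {ps}"
    by (auto simp: contains_once_def)
  moreover have "T_occurrences k m \<alpha> = occurrences \<tau> \<alpha>"
    using * assms by (auto simp: T_occurrences_def avoids_def)
  ultimately show "\<exists>ps. T_occurrences k m \<alpha> = {ps} \<and> ps \<in> occurrences \<tau> \<alpha>" by auto
next
  assume "\<exists>ps. T_occurrences k m \<alpha> = {ps} \<and> ps \<in> occurrences \<tau> \<alpha>"
  then obtain ps where ps: "T_occurrences k m \<alpha> = {ps}" "ps \<in> occurrences \<tau> \<alpha>" by auto
  have "avoids \<alpha> \<sigma>" if \<sigma>: "\<sigma> \<in> T k m - {\<tau>}" for \<sigma>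
  proof (rule ccontr)
    assume "\<not> avoids \<alpha> \<sigma>"
    then have "ps \<in> occurrences \<sigma> \<alpha>"
      using ps(1) \<sigma> by (auto simp: avoids_def T_occurrences_def)
    then have "\<sigma> = \<tau>"
      using \<sigma> assms ps(2)
      by (intro order_isomorphic_imp_eq) (auto simp: in_TD dest: occurrencesD(5))
    with \<sigma> show False by simp
  qed
  moreover have "occurrences \<tau> \<alpha> \<subseteq> {ps}"
    unfolding ps(1)[symmetric] T_occurrences_def using assms by blast
  then have "contains_once \<alpha> \<tau>"
    using ps(2) by (auto simp: contains_once_def)
  ultimately show "(\<forall>\<sigma>\<in>T k m - {\<tau>}. avoids \<alpha> \<sigma>) \<and> contains_once \<alpha> \<tau>" by blast
qed

text \<open>
  The next two lemmas replace positions by the values found there: occurrences of patterns in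
  \<open>T k m\<close> correspond to \<open>k\<close>-element sets of entries in which the leftmost entry has rank \<open>m\<close>.
  The second lemma treats the sets that contain the very first entry of \<open>\<alpha>\<close>, since only the
  occurrences through that entry matter when it is deleted; the pattern is found by replacing each
  entry by its rank in \<open>V\<close>.
\<close>

lemma occurrence_values:
  assumes "\<sigma> \<in> T k m" "ps \<in> occurrences \<sigma> \<alpha>" "distinct \<alpha>" "0 < k" "m \<le> k"
  defines "V \<equiv> (!) \<alpha> ` set ps"
  shows "V \<subseteq> set \<alpha>" "card V = k" "rank V (\<alpha> ! (ps ! 0)) = m"
proof -
  note \<sigma> = in_TD[OF assms(1)] and ps = occurrencesD[OF assms(2)]
  let ?xs = "map ((!) \<alpha>) ps"
  show "V \<subseteq> set \<alpha>" using ps(4) by (auto simp: V_def)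
  have xs: "distinct ?xs"
    using ps(3,4) assms(3) by (auto simp: distinct_map intro!: inj_onI simp: nth_eq_iff_index_eq)
  have V: "V = set ?xs" by (simp add: V_def)
  show "card V = k" using distinct_card[OF xs] ps(1) \<sigma>(3) by (simp add: V)
  have "rank (set ?xs) (?xs ! 0) = rank (set \<sigma>) (\<sigma> ! 0)"
    using xs \<sigma> ps(1,5) assms(4) by (intro rank_nth_cong) auto
  then show "rank V (\<alpha> ! (ps ! 0)) = m"
    using \<sigma> ps(1) assms(4,5) V rank_atLeastAtMost[of m k] by simp
qed

lemma occurrence_from_values:
  assumes "V \<subseteq> set \<alpha>" "card V = k" "distinct \<alpha>" "0 < k"
    and "\<alpha> ! 0 \<in> V" "rank V (\<alpha> ! 0) = m"
  obtains ps where "ps \<in> T_occurrences k m \<alpha>" "(!) \<alpha> ` set ps = V"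
proof -
  define P where "P = {p. p < length \<alpha> \<and> \<alpha> ! p \<in> V}"
  define ps where "ps = sorted_list_of_set P"
  define \<sigma> where "\<sigma> = map (rank V \<circ> (!) \<alpha>) ps"
  have finP: "finite P" by (simp add: P_def)
  have finV: "finite V" using assms(2,4) card_gt_0_iff by blast
  have set_ps: "set ps = P" using finP by (simp add: ps_def)
  have V: "(!) \<alpha> ` P = V" using assms(1) by (auto simp: P_def in_set_conv_nth subset_iff image_iff)
  have inj: "inj_on ((!) \<alpha>) P"
    using assms(3) by (auto simp: P_def intro!: inj_onI simp: nth_eq_iff_index_eq)
  have len: "length ps = k"
    using card_image[OF inj] assms(2) V by (simp add: ps_def)
  have "\<alpha> \<noteq> []" using assms(1,5) by auto
  then have "0 \<in> P" using assms(5) by (simp add: P_def)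
  have sorted: "sorted_wrt (<) ps" by (simp add: ps_def)
  have ps0: "ps ! 0 = 0"
  proof -
    obtain i where "i < k" "ps ! i = 0"
      using \<open>0 \<in> P\<close> set_ps len by (metis in_set_conv_nth)
    then show ?thesis
      using sorted len by (metis bot_nat_0.not_eq_extremum less_zeroE sorted_wrt_nth_less)
  qed
  have bij: "bij_betw (rank V \<circ> (!) \<alpha>) P {1..k}"
    using bij_betw_trans[OF _ bij_betw_rank[OF finV], of "(!) \<alpha>" P] inj V assms(2)
    by (simp add: bij_betw_def)
  have "\<sigma> \<in> T k m"
    using bij set_ps ps0 len assms(4,6)
    by (auto simp: T_def S_def permutations_of_set_def \<sigma>_def bij_betw_def distinct_map ps_def)
  moreover have "ps \<in> occurrences \<sigma> \<alpha>"
  proof -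
    have "\<alpha> ! (ps ! a) \<in> V" if "a < k" for a
      using that set_ps V len nth_mem by blast
    then show ?thesis
      using sorted set_ps len finV
      by (auto simp: occurrences_def \<sigma>_def P_def rank_less_iff)
  qed
  ultimately show ?thesis
    using that[of ps] set_ps V by (auto simp: T_occurrences_def)
qed

lemma occurrences_Cons_without_0:
  "{ps \<in> occurrences \<sigma> (a # xs). 0 \<notin> set ps} = map Suc ` occurrences \<sigma> xs"
proof (intro equalityI subsetI)
  fix ps assume "ps \<in> {ps \<in> occurrences \<sigma> (a # xs). 0 \<notin> set ps}"
  then have ps: "ps \<in> occurrences \<sigma> (a # xs)" "0 \<notin> set ps" by auto
  define qs where "qs = map (\<lambda>p. p - 1) ps"
  have eq: "ps = map Suc qs"
    unfolding qs_def map_map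
  proof (rule map_idI[symmetric])
    fix p assume "p \<in> set ps"
    with ps(2) have "p \<noteq> 0" by metis
    then show "(Suc \<circ> (\<lambda>p. p - 1)) p = p" by simp
  qed
  have "qs \<in> occurrences \<sigma> xs"
    using ps(1) unfolding eq by (auto simp: occurrences_def sorted_wrt_map)
  then show "ps \<in> map Suc ` occurrences \<sigma> xs" using eq by blast
qed (auto simp: occurrences_def sorted_wrt_map)

text \<open>
  Ranks in a subset are at most ranks in the whole set, and likewise for the numbers of larger
  elements. An occurrence through the first entry thus forces enough smaller and enough larger
  entries.
\<close>

lemma T_occurrence_through_0_imp_rank:
  assumes "ps \<in> T_occurrences k m \<alpha>" "distinct \<alpha>" "0 < k" "m \<le> k" "0 \<in> set ps"
  shows "m \<le> rank (set \<alpha>) (\<alpha> ! 0)" "k - m \<le> card (set \<alpha>) - rank (set \<alpha>) (\<alpha> ! 0)"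
proof -
  obtain \<sigma> where \<sigma>: "\<sigma> \<in> T k m" "ps \<in> occurrences \<sigma> \<alpha>"
    using assms(1) by (auto simp: T_occurrences_def)
  define V where "V = (!) \<alpha> ` set ps"
  have ps0: "ps ! 0 = 0"
    using occurrencesD(2)[OF \<sigma>(2)] assms(5)
    by (metis bot_nat_0.not_eq_extremum in_set_conv_nth less_zeroE sorted_wrt_nth_less)
  note V = occurrence_values[OF \<sigma> assms(2-4), folded V_def, unfolded ps0]
  have finV: "finite V" by (simp add: V_def)
  show "m \<le> rank (set \<alpha>) (\<alpha> ! 0)"
    unfolding V(3)[symmetric] rank_def using V(1) by (intro card_mono) auto
  have "k - m = card {y \<in> V. \<alpha> ! 0 < y}"
    using card_greater_eq_diff_rank[OF finV] V(2,3) by simp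
  also have "\<dots> \<le> card {y \<in> set \<alpha>. \<alpha> ! 0 < y}"
    using V(1) by (intro card_mono) auto
  finally show "k - m \<le> card (set \<alpha>) - rank (set \<alpha>) (\<alpha> ! 0)"
    by (simp add: card_greater_eq_diff_rank)
qed

text \<open>
  For a fixed \<open>x \<in> L\<close>, one subset is chosen to contain \<open>x\<close>, the other to avoid it.
\<close>

lemma two_subsets_of_card:
  assumes "finite L" "0 < j" "j < card L"
  obtains B C where "B \<subseteq> L" "C \<subseteq> L" "card B = j" "card C = j" "B \<noteq> C"
proof -
  obtain x where x: "x \<in> L" using assms by fastforce
  have "j \<le> card (L - {x})" using x assms by simp
  then obtain C where C: "C \<subseteq> L - {x}" "card C = j" by (metis obtain_subset_with_card_n)
  have "j - 1 \<le> card (L - {x})" using x assms by simp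
  then obtain D where D: "D \<subseteq> L - {x}" "card D = j - 1" by (metis obtain_subset_with_card_n)
  have "finite D" using D(1) assms(1) by (meson finite_Diff finite_subset)
  then have "card (insert x D) = Suc (card D)"
    using D(1) by (intro card_insert_disjoint) auto
  then have "card (insert x D) = j" using D(2) assms(2) by simp
  then show thesis using that[of "insert x D" C] C D x by auto
qed

text \<open>
  An occurrence through the first entry is completed by \<open>m - 1\<close> of the smaller entries \<open>L\<close> and
  \<open>k - m\<close> of the larger entries \<open>G\<close>. As \<open>\<alpha>\<close> has more than \<open>k\<close> entries, one of \<open>L\<close>, \<open>G\<close> is
  larger than required, and because both \<open>m - 1\<close> and \<open>k - m\<close> are positive, this gives a second
  choice.
\<close>

lemma two_T_occurrences:
  assumes "distinct \<alpha>" "2 \<le> m" "m < k" "k < length \<alpha>"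
    and low: "m \<le> rank (set \<alpha>) (\<alpha> ! 0)"
    and high: "k - m \<le> card (set \<alpha>) - rank (set \<alpha>) (\<alpha> ! 0)"
  shows "\<not> (\<exists>ps. T_occurrences k m \<alpha> = {ps})"
proof -
  let ?a = "\<alpha> ! 0"
  define L where "L = {y \<in> set \<alpha>. y < ?a}"
  define G where "G = {y \<in> set \<alpha>. ?a < y}"
  have a: "?a \<in> set \<alpha>" using assms(4) by (intro nth_mem) linarith
  have cL: "Suc (card L) = rank (set \<alpha>) ?a"
    using a by (simp add: L_def rank_eq_Suc_card_less)
  have cG: "card G = card (set \<alpha>) - rank (set \<alpha>) ?a"
    by (simp add: G_def card_greater_eq_diff_rank)
  have occ: "\<exists>ps. ps \<in> T_occurrences k m \<alpha> \<and> (!) \<alpha> ` set ps = insert ?a (B \<union> C)"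
    if BC: "B \<subseteq> L" "card B = m - 1" "C \<subseteq> G" "card C = k - m" for B C
  proof -
    have B: "y \<in> set \<alpha>" "y < ?a" if "y \<in> B" for y
      using that BC(1) by (auto simp: L_def)
    have C: "y \<in> set \<alpha>" "?a < y" if "y \<in> C" for y
      using that BC(3) by (auto simp: G_def)
    have fin: "finite B" "finite C"
      using B(1) C(1) by (meson List.finite_set finite_subset subsetI)+
    have disj: "B \<inter> C = {}" "?a \<notin> B \<union> C"
      using B(2) C(2) by (auto dest: less_asym)
    have card_V: "card (insert ?a (B \<union> C)) = k"
      using fin disj BC(2,4) assms(2,3) by (simp add: card_Un_disjoint)
    have "{y \<in> insert ?a (B \<union> C). y < ?a} = B"
      using B(2) C(2) by (auto dest: less_asym)
    then have rank_V: "rank (insert ?a (B \<union> C)) ?a = m"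
      using fin BC(2) assms(2) by (simp add: rank_eq_Suc_card_less)
    have V: "insert ?a (B \<union> C) \<subseteq> set \<alpha>" using B(1) C(1) a by blast
    have "0 < k" using assms(3) by simp
    obtain ps where "ps \<in> T_occurrences k m \<alpha>" "(!) \<alpha> ` set ps = insert ?a (B \<union> C)"
      by (rule occurrence_from_values[OF V card_V assms(1) \<open>0 < k\<close> insertI1 rank_V])
    then show ?thesis by blast
  qed
  have recover: "L \<inter> insert ?a (B \<union> C) = B" "G \<inter> insert ?a (B \<union> C) = C"
    if "B \<subseteq> L" "C \<subseteq> G" for B C
    using that by (auto simp: L_def G_def)
  have fin: "finite L" "finite G" by (auto simp: L_def G_def)
  have "rank (set \<alpha>) ?a \<le> card (set \<alpha>)"
    unfolding rank_def by (intro card_mono) auto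
  then have "card L + card G \<ge> k"
    using cL cG assms(1,4) by (simp add: distinct_card)
  then consider "m - 1 < card L" | "k - m < card G" using assms(2,3) by linarith
  then obtain B B' C C' where BC:
    "B \<subseteq> L" "card B = m - 1" "C \<subseteq> G" "card C = k - m"
    "B' \<subseteq> L" "card B' = m - 1" "C' \<subseteq> G" "card C' = k - m" "B \<noteq> B' \<or> C \<noteq> C'"
  proof cases
    case 1
    have "0 < m - 1" using assms(2) by simp
    then obtain B B' where "B \<subseteq> L" "B' \<subseteq> L" "card B = m - 1" "card B' = m - 1" "B \<noteq> B'"
      by (rule two_subsets_of_card[OF fin(1) _ 1])
    moreover have "k - m \<le> card G" using high cG by simp
    then obtain C where "C \<subseteq> G" "card C = k - m"
      by (metis obtain_subset_with_card_n)
    ultimately show ?thesis by (intro that[of B C B' C]) simp_all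
  next
    case 2
    have "0 < k - m" using assms(3) by simp
    then obtain C C' where "C \<subseteq> G" "C' \<subseteq> G" "card C = k - m" "card C' = k - m" "C \<noteq> C'"
      by (rule two_subsets_of_card[OF fin(2) _ 2])
    moreover have "m - 1 \<le> card L" using low cL by simp
    then obtain B where "B \<subseteq> L" "card B = m - 1"
      by (metis obtain_subset_with_card_n)
    ultimately show ?thesis by (intro that[of B C B C']) simp_all
  qed
  obtain ps where ps: "ps \<in> T_occurrences k m \<alpha>" "(!) \<alpha> ` set ps = insert ?a (B \<union> C)"
    using occ[OF BC(1-4)] by blast
  obtain qs where qs: "qs \<in> T_occurrences k m \<alpha>" "(!) \<alpha> ` set qs = insert ?a (B' \<union> C')"
    using occ[OF BC(5-8)] by blast
  have "ps \<noteq> qs"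
  proof
    assume "ps = qs"
    then have eq: "insert ?a (B \<union> C) = insert ?a (B' \<union> C')" using ps(2) qs(2) by metis
    have "B = B'" "C = C'"
      using recover[OF BC(1,3), unfolded eq] recover[OF BC(5,7)] by (metis, metis)
    with BC(9) show False by blast
  qed
  then show ?thesis using ps(1) qs(1) by (metis singletonD)
qed

section \<open>Counting\<close>

text \<open>
  This is \<^const>\<open>S_avoid_once\<close> with an arbitrary set of entries, so that deleting the first entry
  of an arrangement needs no renumbering.
\<close>

definition avoid_once :: "nat set \<Rightarrow> nat list set \<Rightarrow> nat list \<Rightarrow> nat list set" where
  "avoid_once A P \<tau> =
     {\<alpha> \<in> permutations_of_set A. (\<forall>\<sigma> \<in> P - {\<tau>}. avoids \<alpha> \<sigma>) \<and> contains_once \<alpha> \<tau>}"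

lemma avoid_once_T_eq:
  assumes "\<tau> \<in> T k m"
  shows "avoid_once A (T k m) \<tau> =
    {\<alpha> \<in> permutations_of_set A. \<exists>ps. T_occurrences k m \<alpha> = {ps} \<and> ps \<in> occurrences \<tau> \<alpha>}"
  using avoid_others_contains_once_iff[OF assms]
  by (auto simp: avoid_once_def permutations_of_set_def)

text \<open>
  The values \<open>a\<close> for which an arrangement of \<open>A\<close> that begins with \<open>a\<close> has no occurrence through
  its first entry: fewer than \<open>m - 1\<close> elements of \<open>A\<close> are smaller than \<open>a\<close>, since the rank also
  counts \<open>a\<close>, or fewer than \<open>k - m\<close> are larger.
\<close>

definition admissible :: "nat \<Rightarrow> nat \<Rightarrow> nat set \<Rightarrow> nat set" where
  "admissible k m A = {a \<in> A. rank A a < m \<or> card A - rank A a < k - m}"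

text \<open>
  Ranks run through \<open>1, \<dots>, card A\<close>, so the \<open>m - 1\<close> smallest and the \<open>k - m\<close> largest elements of
  \<open>A\<close> are admissible. They do not overlap because \<open>k - 1 < card A\<close>.
\<close>

lemma card_admissible:
  assumes "finite A" "2 \<le> m" "m < k" "k \<le> card A"
  shows "card (admissible k m A) = k - 1"
proof -
  let ?R = "{r \<in> {1..card A}. r < m \<or> card A - r < k - m}"
  have bij: "bij_betw (rank A) A {1..card A}" using assms(1) by (rule bij_betw_rank)
  have "rank A ` admissible k m A = ?R"
  proof -
    have "rank A ` A = {1..card A}" using bij by (simp add: bij_betw_def)
    then show ?thesis unfolding admissible_def by (auto simp: set_eq_iff image_iff) metis+
  qed
  moreover have "inj_on (rank A) (admissible k m A)"
    using inj_on_rank[OF assms(1)] by (rule inj_on_subset) (auto simp: admissible_def)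
  ultimately have "card (admissible k m A) = card ?R" by (metis card_image)
  also have "?R = {1..<m} \<union> {card A - (k - m) + 1..card A}" using assms by auto
  also have "card \<dots> = (m - 1) + (k - m)"
    using assms by (subst card_Un_disjoint) auto
  finally show ?thesis using assms by simp
qed

text \<open>
  An admissible first entry lies in no occurrence, so the occurrences are those of the tail,
  shifted by one position. Any other first entry lies in at least two.
\<close>

lemma Cons_in_avoid_once_iff:
  assumes "\<tau> \<in> T k m" "2 \<le> m" "m < k" "k < card A" "a \<in> A" "finite A"
  shows "a # xs \<in> avoid_once A (T k m) \<tau> \<longleftrightarrow>
    a \<in> admissible k m A \<and> xs \<in> avoid_once (A - {a}) (T k m) \<tau>"
proof (cases "a # xs \<in> permutations_of_set A")
  case False
  then show ?thesis using assms(5) by (auto simp: avoid_once_def permutations_of_set_def)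
next
  case True
  let ?\<alpha> = "a # xs"
  have \<alpha>: "set ?\<alpha> = A" "distinct ?\<alpha>" using True by (auto simp: permutations_of_set_def)
  have xs: "xs \<in> permutations_of_set (A - {a})" using \<alpha> by (auto simp: permutations_of_set_def)
  have len: "length ?\<alpha> = card A" using \<alpha> distinct_card by metis
  show ?thesis
  proof (cases "a \<in> admissible k m A")
    case False
    then have "\<not> (\<exists>ps. T_occurrences k m ?\<alpha> = {ps})"
      using \<alpha> len assms
      by (intro two_T_occurrences) (auto simp: admissible_def)
    then show ?thesis using False avoid_once_T_eq[OF assms(1)] by blast
  next
    case adm: True
    have no0: "0 \<notin> set ps" if "ps \<in> T_occurrences k m ?\<alpha>" for ps
    proof
      assume "0 \<in> set ps"
      then have "m \<le> rank A a" "k - m \<le> card A - rank A a"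
        using T_occurrence_through_0_imp_rank[OF that \<alpha>(2)] assms(3) \<alpha>(1) by auto
      then show False using adm by (simp add: admissible_def)
    qed
    have occ: "occurrences \<sigma> ?\<alpha> = map Suc ` occurrences \<sigma> xs" if "\<sigma> \<in> T k m" for \<sigma>
      using no0 that occurrences_Cons_without_0[of \<sigma> a xs] by (auto simp: T_occurrences_def)
    have Tocc: "T_occurrences k m ?\<alpha> = map Suc ` T_occurrences k m xs"
      using occ by (auto simp: T_occurrences_def)
    have inj: "inj (map Suc)" by simp
    have "(\<exists>ps. T_occurrences k m ?\<alpha> = {ps} \<and> ps \<in> occurrences \<tau> ?\<alpha>) \<longleftrightarrow>
          (\<exists>ps. T_occurrences k m xs = {ps} \<and> ps \<in> occurrences \<tau> xs)"
      unfolding Tocc occ[OF assms(1)]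
    proof
      assume "\<exists>ps. map Suc ` T_occurrences k m xs = {ps} \<and> ps \<in> map Suc ` occurrences \<tau> xs"
      then obtain qs where "map Suc ` T_occurrences k m xs = map Suc ` {qs}"
        "qs \<in> occurrences \<tau> xs" by auto
      then show "\<exists>ps. T_occurrences k m xs = {ps} \<and> ps \<in> occurrences \<tau> xs"
        using inj by (metis inj_image_eq_iff)
    qed auto
    then show ?thesis using adm xs True avoid_once_T_eq[OF assms(1)] by auto
  qed
qed

lemma avoid_once_eq_UN:
  assumes "\<tau> \<in> T k m" "2 \<le> m" "m < k" "k < card A" "finite A"
  shows "avoid_once A (T k m) \<tau> =
    (\<Union>a\<in>admissible k m A. (#) a ` avoid_once (A - {a}) (T k m) \<tau>)" (is "?l = ?r")
proof (intro equalityI subsetI)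
  note step = Cons_in_avoid_once_iff[OF assms(1-4) _ assms(5)]
  {
    fix \<alpha> assume \<alpha>: "\<alpha> \<in> ?l"
    then have A: "set \<alpha> = A" by (simp add: avoid_once_def permutations_of_set_def)
    have "\<alpha> \<noteq> []" using A assms(4) by auto
    then obtain a xs where ax: "\<alpha> = a # xs" by (cases \<alpha>) auto
    then have "a \<in> A" using A by auto
    then have "a \<in> admissible k m A" "xs \<in> avoid_once (A - {a}) (T k m) \<tau>"
      using \<alpha> step[of a xs] unfolding ax by blast+
    then show "\<alpha> \<in> ?r" unfolding ax by blast
  next
    fix \<alpha> assume "\<alpha> \<in> ?r"
    then obtain a xs where ax: "\<alpha> = a # xs" "a \<in> admissible k m A"
      "xs \<in> avoid_once (A - {a}) (T k m) \<tau>" by blast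
    then have "a \<in> A" by (simp add: admissible_def)
    then show "\<alpha> \<in> ?l" using ax step[of a xs] by blast
  }
qed

lemma occurrences_same_length:
  assumes "length \<alpha> = length \<sigma>" "ps \<in> occurrences \<sigma> \<alpha>"
  shows "ps = [0..<length \<sigma>]"
proof -
  note ps = occurrencesD[OF assms(2)]
  have "set ps \<subseteq> {..<length \<sigma>}" using ps(4) assms(1) by auto
  moreover have "card (set ps) = length \<sigma>" using ps(1,3) by (simp add: distinct_card)
  ultimately have "set ps = {..<length \<sigma>}" by (intro card_subset_eq) auto
  then show ?thesis
    using ps(2) by (intro strict_sorted_equal) (auto simp: atLeast0LessThan)
qed

text \<open>
  With only \<open>k\<close> entries the sole candidate for an occurrence consists of all positions. The
  arrangement therefore has the pattern \<open>\<tau>\<close> itself, and it arises from \<open>\<tau>\<close> by replacing each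
  number \<open>i\<close> by the element of \<open>A\<close> of rank \<open>i\<close>.
\<close>

lemma avoid_once_base:
  assumes "\<tau> \<in> T k m" "card A = k" "finite A"
  shows "card (avoid_once A (T k m) \<tau>) = 1"
proof -
  note \<tau> = in_TD[OF assms(1)]
  let ?f = "inv_into A (rank A)"
  let ?\<beta> = "map ?f \<tau>"
  have iso: "\<alpha> \<in> avoid_once A (T k m) \<tau> \<longleftrightarrow> [0..<k] \<in> occurrences \<tau> \<alpha>"
    if \<alpha>: "\<alpha> \<in> permutations_of_set A" for \<alpha>
  proof -
    have len: "length \<alpha> = k" "distinct \<alpha>"
      using \<alpha> assms(2) by (auto simp: permutations_of_set_def distinct_card)
    have "T_occurrences k m \<alpha> \<subseteq> {[0..<k]}"
    proof
      fix ps assume "ps \<in> T_occurrences k m \<alpha>"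
      then obtain \<sigma> where "\<sigma> \<in> T k m" "ps \<in> occurrences \<sigma> \<alpha>"
        by (auto simp: T_occurrences_def)
      then show "ps \<in> {[0..<k]}"
        using occurrences_same_length[of \<alpha> \<sigma> ps] in_TD(3)[of \<sigma> k m] len(1) by simp
    qed
    then show ?thesis
      using \<alpha> assms(1) by (auto simp: avoid_once_T_eq[OF assms(1)] T_occurrences_def)
  qed
  have bij: "bij_betw ?f {1..k} A"
    using bij_betw_inv_into[OF bij_betw_rank[OF assms(3)]] assms(2) by simp
  have \<beta>: "?\<beta> \<in> permutations_of_set A"
    using bij \<tau> by (auto simp: permutations_of_set_def bij_betw_def distinct_map)
  have rank_f: "?f x \<in> A" "rank A (?f x) = x" if "x \<in> {1..k}" for x
    using that bij_betw_rank[OF assms(3)] assms(2)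
    by (auto simp: bij_betw_def f_inv_into_f inv_into_into)
  have mono: "?f x < ?f y \<longleftrightarrow> x < y" if "x \<in> {1..k}" "y \<in> {1..k}" for x y
    using that rank_less_iff[OF assms(3) rank_f(1) rank_f(1), of x y] rank_f(2) by simp
  have "\<tau> ! i \<in> {1..k}" if "i < k" for i using that \<tau> nth_mem by metis
  then have "[0..<k] \<in> occurrences \<tau> ?\<beta>"
    using \<tau>(3) mono by (auto simp: occurrences_def)
  then have mem: "?\<beta> \<in> avoid_once A (T k m) \<tau>" using iso \<beta> by blast
  have uniq: "\<alpha> = ?\<beta>" if "\<alpha> \<in> avoid_once A (T k m) \<tau>" for \<alpha>
  proof (rule order_isomorphic_imp_eq)
    have \<alpha>: "\<alpha> \<in> permutations_of_set A" using that by (simp add: avoid_once_def)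
    then show "distinct \<alpha>" "distinct ?\<beta>" "set \<alpha> = set ?\<beta>"
      using \<beta> by (auto simp: permutations_of_set_def)
    have "length \<alpha> = k" using \<alpha> assms(2) by (auto simp: permutations_of_set_def distinct_card)
    then show "\<forall>a<length \<alpha>. \<forall>b<length \<alpha>. \<alpha> ! a < \<alpha> ! b \<longleftrightarrow> ?\<beta> ! a < ?\<beta> ! b"
      using occurrencesD(5)[of "[0..<k]" \<tau> \<alpha>] occurrencesD(5)[of "[0..<k]" \<tau> ?\<beta>]
        \<open>[0..<k] \<in> occurrences \<tau> ?\<beta>\<close> iso[OF \<alpha>] that \<tau>(3) by auto
  qed
  have "avoid_once A (T k m) \<tau> = {?\<beta>}" using mem uniq by blast
  then show ?thesis by simp
qed

lemma card_avoid_once: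
  assumes "\<tau> \<in> T k m" "2 \<le> m" "m < k" "finite A" "card A = k + d"
  shows "card (avoid_once A (T k m) \<tau>) = (k - 1) ^ d"
  using assms(4,5)
proof (induction d arbitrary: A)
  case 0
  then show ?case using avoid_once_base[OF assms(1)] by simp
next
  case (Suc d)
  let ?g = "\<lambda>a. (#) a ` avoid_once (A - {a}) (T k m) \<tau>"
  have fin: "finite (admissible k m A)" using Suc.prems by (simp add: admissible_def)
  have "card (avoid_once A (T k m) \<tau>) = card (\<Union>a\<in>admissible k m A. ?g a)"
    using Suc.prems avoid_once_eq_UN[OF assms(1-3), of A] by simp
  also have "\<dots> = (\<Sum>a\<in>admissible k m A. card (?g a))"
    using fin by (intro card_UN_disjoint) (auto simp: avoid_once_def)
  also have "\<dots> = (\<Sum>a\<in>admissible k m A. (k - 1) ^ d)"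
  proof (rule sum.cong)
    fix a assume "a \<in> admissible k m A"
    then have "card (A - {a}) = k + d" using Suc.prems by (simp add: admissible_def)
    then show "card (?g a) = (k - 1) ^ d"
      using Suc.IH[of "A - {a}"] Suc.prems by (simp add: card_image)
  qed simp
  also have "\<dots> = (k - 1) ^ Suc d"
    using card_admissible[of A m k] Suc.prems assms by simp
  finally show ?case .
qed

theorem theorem4p1:
  fixes m k n :: nat and \<tau> :: "nat list"
  assumes "2 \<le> m" and "m < k" and "k \<le> n"
    and "\<tau> \<in> T k m"
  shows "card (S_avoid_once n (T k m) \<tau>) = (k - 1) ^ (n - k)"
proof -
  have "S_avoid_once n (T k m) \<tau> = avoid_once {1..n} (T k m) \<tau>"
    by (simp add: S_avoid_once_def avoid_once_def S_def)
  then show ?thesis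
    using card_avoid_once[of \<tau> k m "{1..n}" "n - k"] assms by simp
qed

end
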